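(* Let $n\in\mathbb N$ and let $(X,\langle\cdot|\cdot\rangle)$ be any complex inner product space of complex dimension $n$ (so of real dimension $2n$). Then there does not exist a set $B=\{v_1,v_2,\dots,v_n,v_{n+1}\}\subset X$ of $n+1$ elements such that $B$ is $\mathbb R$-linearly independent and all angles in $B$ are real, i.e. $\angle(v_j,v_k)\in\mathbb R$ for all $j,k$.
   Context: A complex inner product is homogeneous over $\mathbb C$ in the first component, conjugate symmetric, positive definite and additive, and $\|x\|=\sqrt{\langle x|x\rangle}$. For $x,y\in X\setminus\{0\}$ the angle is $\angle(x,y):=\arccos\big(\langle x|y\rangle/(\|x\|\,\|y\|)\big)$, where $\arccos:\mathcal B\to\mathcal A$ is the inverse of the homeomorphism $\cos:\mathcal A\to\mathcal B$ obtained by restricting the complex cosine, with $\mathcal A:=\{a+ib\mid 0<a<\pi,\ b\in\mathbb R\}\cup\{0,\pi\}$ and $\mathcal B:=\mathbb C\setminus\{r\in\mathbb R\mid r<-1\text{ or }r>1\}$. For nonzero $x,y$ the angle is real if and only if $\langle x|y\rangle\in\mathbb R$. *)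

theory Defs
  imports "HOL-Analysis.Analysis"
begin

definition arccos_range :: "complex set" where
  "arccos_range = {z. 0 < Re z \<and> Re z < pi} \<union> {0, of_real pi}"

definition arccos_domain :: "complex set" where
  "arccos_domain = UNIV - complex_of_real ` {r. r < -1 \<or> r > 1}"

definition carccos :: "complex \<Rightarrow> complex" where
  "carccos = the_inv_into arccos_range cos"

lemma Arccos_cos_arccos_range: "z \<in> arccos_range \<Longrightarrow> Arccos (cos z) = z"
  by (rule Arccos_cos) (auto simp: arccos_range_def)

lemma bij_betw_cos_arccos: "bij_betw cos arccos_range arccos_domain"
  unfolding bij_betw_def
proof
  show "inj_on cos arccos_range"
    by (metis Arccos_cos_arccos_range inj_onI)
  show "cos ` arccos_range = arccos_domain"
  proof (intro set_eqI iffI)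
    fix w assume "w \<in> cos ` arccos_range"
    then obtain z where z: "z \<in> arccos_range" "w = cos z" by blast
    have "\<bar>r\<bar> \<le> 1" if w: "w = of_real r" for r
    proof (cases "z = 0 \<or> z = of_real pi")
      case True
      then have "w = of_real (cos (Re z))" using z by (auto simp: cos_of_real)
      then show ?thesis using w by (simp only: of_real_eq_iff) simp
    next
      case False
      then have "sin (Re z) \<noteq> 0"
        using z sin_gt_zero[of "Re z"] by (auto simp: arccos_range_def)
      moreover have "Im (cos z) = 0" using w z by simp
      ultimately have "Im z = 0" by (simp add: Im_cos)
      then have "z = of_real (Re z)" by (simp add: complex_eq_iff)
      then have "w = of_real (cos (Re z))" using z by (metis cos_of_real)
      then show ?thesis using w by (simp only: of_real_eq_iff) simp
    qed
    then show "w \<in> arccos_domain" by (fastforce simp: arccos_domain_def)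
  next
    fix w assume w: "w \<in> arccos_domain"
    define z where "z = Arccos w"
    have c: "cos z = w" "cos (- z) = w" by (simp_all add: z_def)
    have b: "-pi < Re z" "Re z \<le> pi" using Re_Arccos_bounds[of w] by (auto simp: z_def)
    show "w \<in> cos ` arccos_range"
    proof (cases "Re z = 0 \<or> Re z = pi")
      case True
      define r where "r = Re w"
      have "Im w = 0" using True c(1) Im_cos[of z] by auto
      then have r: "w = of_real r" by (simp add: r_def complex_eq_iff)
      have "1 \<le> (exp (Im z) + exp (- Im z)) / 2"
        using cosh_real_ge_1[of "Im z"] by (simp add: cosh_def)
      then have "1 \<le> \<bar>r\<bar>" using True c(1) Re_cos[of z] by (auto simp: r_def)
      moreover have "\<bar>r\<bar> \<le> 1" using w r by (force simp: arccos_domain_def)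
      ultimately have "w = 1 \<or> w = -1" using r by (auto simp: abs_if split: if_splits)
      moreover have "cos 0 = (1::complex)" "cos (of_real pi) = (-1::complex)"
        by (simp_all add: cos_of_real)
      moreover have "0 \<in> arccos_range" "of_real pi \<in> arccos_range"
        by (simp_all add: arccos_range_def)
      ultimately show ?thesis by (metis image_eqI)
    next
      case False
      with b have "z \<in> arccos_range \<or> - z \<in> arccos_range" by (auto simp: arccos_range_def)
      then show ?thesis using c by (metis imageI)
    qed
  qed
qed

lemma carccos_eq_Arccos: "w \<in> arccos_domain \<Longrightarrow> carccos w = Arccos w"
proof -
  assume "w \<in> arccos_domain"
  then obtain z where z: "z \<in> arccos_range" "w = cos z"
    using bij_betw_cos_arccos by (auto simp: bij_betw_def)
  then show ?thesis
    using bij_betw_cos_arccos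
    by (simp add: carccos_def bij_betw_def the_inv_into_f_f Arccos_cos_arccos_range)
qed

text \<open>The space is the whole type. Since conjugate symmetry forces \<open>cinner x x\<close> to be real, its
  positivity is stated for the real part.\<close>

locale complex_inner_space = vector_space scale
  for scale :: "complex \<Rightarrow> 'a::ab_group_add \<Rightarrow> 'a" +
  fixes cinner :: "'a \<Rightarrow> 'a \<Rightarrow> complex"
  assumes cinner_scale_left: "cinner (scale c x) y = c * cinner x y"
    and cinner_add_left: "cinner (x + y) z = cinner x z + cinner y z"
    and cinner_commute: "cinner x y = cnj (cinner y x)"
    and cinner_pos: "x \<noteq> 0 \<Longrightarrow> 0 < Re (cinner x x)"
begin

definition cnorm :: "'a \<Rightarrow> real" where
  "cnorm x = sqrt (Re (cinner x x))"

text \<open>Only meaningful for \<open>x \<noteq> 0\<close> and \<open>y \<noteq> 0\<close>.\<close>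

definition angle :: "'a \<Rightarrow> 'a \<Rightarrow> complex" where
  "angle x y = carccos (cinner x y / of_real (cnorm x * cnorm y))"

lemma cinner_self: "cinner x x = of_real ((cnorm x)\<^sup>2)"
proof -
  have "cinner 0 0 = 0" using cinner_scale_left[of 0 0 0] by simp
  then have "0 \<le> Re (cinner x x)" using cinner_pos[of x] by (cases "x = 0") auto
  moreover have "Im (cinner x x) = 0"
    using arg_cong[OF cinner_commute[of x x], of Im] by simp
  ultimately show ?thesis by (simp add: cnorm_def complex_eq_iff)
qed

lemma real_vector_space: "vector_space (\<lambda>r::real. scale (of_real r))"
  by unfold_locales (simp_all add: scale_right_distrib scale_left_distrib)

end

end

theory Submission
  imports Defs
begin

text \<open>If all inner products between elements of \<open>B\<close> are real, then so are those between elements of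
  its real span. From a complex relation \<open>p + \<i> q = 0\<close> with \<open>p\<close>, \<open>q\<close> in that span one gets
  \<open>\<langle>p|q\<rangle> = -\<i> \<langle>q|q\<rangle>\<close>, which is real only for \<open>q = 0\<close>. Hence real independence of \<open>B\<close>
  implies complex independence, and \<open>B\<close> has at most \<open>n\<close> elements.\<close>

text \<open>On \<open>arccos_domain\<close>, \<open>w\<close> is the cosine of a real number. Every
  point outside \<open>arccos_domain\<close> is real by definition, so the unspecified value of
  \<open>carccos\<close> there does no harm.\<close>

lemma carccos_Reals_imp:
  assumes "carccos w \<in> \<real>"
  shows "w \<in> \<real>"
proof (cases "w \<in> arccos_domain")
  case True
  then have "w = cos (carccos w)"
    by (simp add: carccos_eq_Arccos)
  also obtain r where "carccos w = of_real r"
    using assms by (rule Reals_cases)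
  finally show ?thesis
    by (simp add: cos_of_real)
next
  case False
  then show ?thesis
    by (auto simp: arccos_domain_def)
qed

context complex_inner_space
begin

sublocale real: vector_space "\<lambda>r::real. scale (of_real r)"
  by (rule real_vector_space)

lemma cnorm_pos: "x \<noteq> 0 \<Longrightarrow> 0 < cnorm x"
  by (simp add: cnorm_def cinner_pos)

lemma cinner_Reals_if_angle_Reals:
  assumes "x \<noteq> 0" "y \<noteq> 0" "angle x y \<in> \<real>"
  shows "cinner x y \<in> \<real>"
proof -
  have "cinner x y / of_real (cnorm x * cnorm y) \<in> \<real>"
    using assms(3) unfolding angle_def by (rule carccos_Reals_imp)
  \<comment> \<open>Multiplying back by the real denominator keeps the quotient real; since both
    norms are positive, the denominator cancels.\<close>
  then have "cinner x y / of_real (cnorm x * cnorm y) * of_real (cnorm x * cnorm y) \<in> \<real>"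
    by (rule Reals_mult) simp
  then show ?thesis
    using assms cnorm_pos[of x] cnorm_pos[of y] by simp
qed

lemma cinner_zero_left: "cinner 0 y = 0"
  using cinner_scale_left[of 0 0 y] by simp

lemma cinner_Reals_commute: "cinner x y \<in> \<real> \<Longrightarrow> cinner y x \<in> \<real>"
  using Reals_cnj_iff cinner_commute by metis

text \<open>For fixed \<open>y\<close>, the vectors whose inner product with \<open>y\<close> is
  real form a real subspace, by additivity and homogeneity in the first argument.\<close>

lemma cinner_Reals_real_span_left:
  assumes "x \<in> real.span B" "\<And>b. b \<in> B \<Longrightarrow> cinner b y \<in> \<real>"
  shows "cinner x y \<in> \<real>"
  using assms(1)
proof (induction rule: real.span_induct_alt)
  case base
  show ?case by (simp add: cinner_zero_left)
next
  case (step c b x)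
  then show ?case
    using assms(2) by (simp add: cinner_add_left cinner_scale_left)
qed

text \<open>The one-sided version is applied to each argument in turn; conjugate symmetry carries
  realness from one side to the other.\<close>

lemma cinner_Reals_real_span:
  assumes "x \<in> real.span B" "y \<in> real.span B" "\<And>a b. a \<in> B \<Longrightarrow> b \<in> B \<Longrightarrow> cinner a b \<in> \<real>"
  shows "cinner x y \<in> \<real>"
proof (rule cinner_Reals_real_span_left[OF assms(1)])
  fix b assume "b \<in> B"
  then have "cinner y b \<in> \<real>"
    using assms(3) by (intro cinner_Reals_real_span_left[OF assms(2)])
  then show "cinner b y \<in> \<real>"
    by (rule cinner_Reals_commute)
qed

lemma cinner_Reals_add_scale_ii_eq_0:
  assumes "cinner p q \<in> \<real>" "p + scale \<i> q = 0"
  shows "p = 0" "q = 0"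
proof -
  have "p = scale (- \<i>) q"
    using assms(2) by (simp add: eq_neg_iff_add_eq_0)
  then have "cinner p q = - \<i> * cinner q q"
    by (simp only: cinner_scale_left)
  then have "Im (cinner p q) = - Re (cinner q q)"
    by simp
  then have "Re (cinner q q) = 0"
    using assms(1) by (simp add: complex_is_Real_iff)
  then show "q = 0"
    using cinner_pos[of q] by fastforce
  then show "p = 0"
    using assms(2) by simp
qed

lemma independent_if_real_independent:
  assumes indep: "real.independent B" and inner: "\<And>a b. a \<in> B \<Longrightarrow> b \<in> B \<Longrightarrow> cinner a b \<in> \<real>"
  shows "independent B"
  unfolding independent_explicit_module
proof (intro allI impI)
  fix T u v
  assume T: "finite T" "T \<subseteq> B" and sum: "(\<Sum>v\<in>T. scale (u v) v) = 0" and v: "v \<in> T"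
  \<comment> \<open>Splitting each coefficient \<open>u v\<close> into real and imaginary parts
    turns the complex relation into \<open>p + scale \<i> q = 0\<close>.\<close>
  define p where "p = (\<Sum>v\<in>T. scale (of_real (Re (u v))) v)"
  define q where "q = (\<Sum>v\<in>T. scale (of_real (Im (u v))) v)"
  have "p \<in> real.span B" "q \<in> real.span B"
    unfolding p_def q_def using T(2)
    by (auto intro!: real.span_sum real.span_scale[OF real.span_base])
  then have pq: "cinner p q \<in> \<real>"
    using inner by (rule cinner_Reals_real_span)
  have "scale (u v) v = scale (of_real (Re (u v))) v + scale \<i> (scale (of_real (Im (u v))) v)" for v
    by (simp add: scale_left_distrib[symmetric] complex_eq[symmetric])
  then have "p + scale \<i> q = 0"
    using sum by (simp add: p_def q_def sum.distrib scale_sum_right)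
  then have "p = 0" "q = 0"
    using cinner_Reals_add_scale_ii_eq_0[OF pq] by simp_all
  \<comment> \<open>Both \<open>p = 0\<close> and \<open>q = 0\<close> are relations over
    \<open>T\<close> with real coefficients, so real independence applies to each.\<close>
  then have "Re (u v) = 0" "Im (u v) = 0"
    using real.independentD[OF indep T _ v, of "\<lambda>v. Re (u v)"]
      real.independentD[OF indep T _ v, of "\<lambda>v. Im (u v)"]
    unfolding p_def q_def by simp_all
  then show "u v = 0"
    by (simp add: complex_eq_iff)
qed

end

theorem corollary4p5:
  fixes scale :: "complex \<Rightarrow> 'a::ab_group_add \<Rightarrow> 'a"
    and cinner :: "'a \<Rightarrow> 'a \<Rightarrow> complex"
    and E :: "'a set"
    and n :: nat
  assumes "complex_inner_space scale cinner"
    and "finite_dimensional_vector_space scale E"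
    and "vector_space.dim scale (UNIV :: 'a set) = n"
  shows "\<not> (\<exists>B :: 'a set. card B = n + 1 \<and>
             \<not> module.dependent (\<lambda>r::real. scale (complex_of_real r)) B \<and>
             (\<forall>x\<in>B. \<forall>y\<in>B. complex_inner_space.angle cinner x y \<in> \<real>))"
proof
  interpret complex_inner_space scale cinner by fact
  interpret finite_dimensional_vector_space scale E by fact
  assume "\<exists>B :: 'a set. card B = n + 1 \<and> real.independent B \<and> (\<forall>x\<in>B. \<forall>y\<in>B. angle x y \<in> \<real>)"
  then obtain B where card: "card B = n + 1" and indep: "real.independent B"
    and angle: "\<And>x y. x \<in> B \<Longrightarrow> y \<in> B \<Longrightarrow> angle x y \<in> \<real>"
    by blast
  \<comment> \<open>Realness of an angle says something about the inner product only for nonzero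
    vectors.\<close>
  have "0 \<notin> B"
    using indep real.dependent_zero by blast
  then have "cinner x y \<in> \<real>" if "x \<in> B" "y \<in> B" for x y
    using that angle by (metis cinner_Reals_if_angle_Reals)
  then have "independent B"
    using indep by (intro independent_if_real_independent)
  then have "card B \<le> n"
    using independent_card_le_dim[of B UNIV] assms(3) by simp
  then show False
    using card by simp
qed

end
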